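(* Let \[ \mathcal{F}=\Big\{\tfrac12\sum_{i=1}^{\infty}\left(-\tfrac32\right)^{-i}\varphi(d_{-i})\;\Big|\;d_{-i}\in\{0,1,2\}\Big\}\subset\mathbb{K}. \] Then $\mathcal{F}$ is the closure of its interior in $\mathbb{K}$.
   Context: $\mathbb{Q}_2$ is the field of $2$-adic numbers with the $2$-adic absolute value $|\cdot|_2$. $\mathbb{K}=\mathbb{R}\times\mathbb{Q}_2$ with componentwise addition, multiplication by a rational $\alpha$ given by $\alpha(x_1,x_2)=(\alpha x_1,\alpha x_2)$, and the metric $\mathbf{d}((x_1,x_2),(y_1,y_2))=\max\{|x_1-y_1|,|x_2-y_2|_2\}$ (which defines the topology, interior and closure). $\varphi:\mathbb{Q}\to\mathbb{K}$ is $\varphi(z)=(z,z)$. The series defining elements of $\mathcal{F}$ converge in $\mathbb{K}$ since $|-\tfrac23|<1$ and $|-\tfrac23|_2=\tfrac12<1$. *)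

theory Defs
  imports "HOL-Analysis.Analysis" "HOL-Computational_Algebra.Primes"
begin

section \<open>The 2-adic absolute value on the rationals\<close>

text \<open>
  For \<open>x = a / b\<close> this is \<open>2\<close> to the power \<open>-v(x)\<close>, where \<open>v(x)\<close> is the multiplicity of \<open>2\<close> in \<open>a\<close>
  minus that in \<open>b\<close>.
\<close>

definition abs2 :: "rat \<Rightarrow> real" where
  "abs2 x = (if x = 0 then 0 else
     (case quotient_of x of (a, b) \<Rightarrow>
       2 powi (int (multiplicity 2 b) - int (multiplicity 2 a))))"

lemma abs2_0 [simp]: "abs2 0 = 0"
  by (simp add: abs2_def)

lemma mult2_mult:
  "a \<noteq> 0 \<Longrightarrow> b \<noteq> 0 \<Longrightarrow> multiplicity 2 (a * b :: int) = multiplicity 2 a + multiplicity 2 b"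
  by (intro prime_elem_multiplicity_mult_distrib prime_imp_prime_elem) auto

lemma abs2_frac:
  fixes a b :: int
  assumes "a \<noteq> 0" "b \<noteq> 0"
  shows "abs2 (of_int a / of_int b) = 2 powi (int (multiplicity 2 b) - int (multiplicity 2 a))"
proof -
  define x :: rat where "x = of_int a / of_int b"
  obtain p q where pq: "quotient_of x = (p, q)"
    by (cases "quotient_of x")
  have q: "q > 0" and x: "x = of_int p / of_int q"
    using quotient_of_denom_pos[OF pq] quotient_of_div[OF pq] by auto
  have "x \<noteq> 0"
    using assms by (simp add: x_def)
  then have p: "p \<noteq> 0"
    using x by auto
  have "(of_int (a * q) :: rat) = of_int (p * b)"
    using x x_def q assms by (simp add: field_simps)
  then have "a * q = p * b"
    by linarith
  then have "multiplicity 2 a + multiplicity 2 q = multiplicity 2 p + multiplicity 2 b"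
    using mult2_mult[of a q] mult2_mult[of p b] assms p q by simp
  then have "int (multiplicity 2 q) - int (multiplicity 2 p)
      = int (multiplicity 2 b) - int (multiplicity 2 a)"
    by linarith
  then show ?thesis
    using \<open>x \<noteq> 0\<close> pq unfolding abs2_def by (simp flip: x_def)
qed

lemma rat_fracE:
  fixes x :: rat
  obtains a b :: int where "x = of_int a / of_int b" "b \<noteq> 0"
proof -
  obtain p q where pq: "quotient_of x = (p, q)"
    by (cases "quotient_of x")
  show ?thesis
    using that[of p q] quotient_of_denom_pos[OF pq] quotient_of_div[OF pq] by simp
qed

lemma abs2_nonneg [simp]: "0 \<le> abs2 x"
  by (simp add: abs2_def split: prod.split)

lemma abs2_eq_0_iff [simp]: "abs2 x = 0 \<longleftrightarrow> x = 0"
  by (simp add: abs2_def split: prod.split)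

lemma abs2_1 [simp]: "abs2 1 = 1"
  using abs2_frac[of 1 1] by simp

lemma abs2_2: "abs2 2 = 1 / 2"
  using abs2_frac[of 2 1] by (simp add: power_int_minus)

lemma abs2_mult: "abs2 (x * y) = abs2 x * abs2 y"
proof (cases "x = 0 \<or> y = 0")
  case False
  obtain a b where x: "x = of_int a / of_int b" "b \<noteq> 0" by (rule rat_fracE)
  obtain c d where y: "y = of_int c / of_int d" "d \<noteq> 0" by (rule rat_fracE)
  have a: "a \<noteq> 0" and c: "c \<noteq> 0"
    using False x y by auto
  have "x * y = of_int (a * c) / of_int (b * d)"
    by (simp add: x y)
  then have "abs2 (x * y) = 2 powi (int (multiplicity 2 (b * d)) - int (multiplicity 2 (a * c)))"
    using abs2_frac[of "a * c" "b * d"] a c x y by simp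
  also have "\<dots> = 2 powi ((int (multiplicity 2 b) - int (multiplicity 2 a))
      + (int (multiplicity 2 d) - int (multiplicity 2 c)))"
    using a c x y by (simp add: mult2_mult algebra_simps)
  also have "\<dots> = abs2 x * abs2 y"
    using a c x y by (simp add: abs2_frac power_int_add)
  finally show ?thesis .
qed auto

lemma abs2_minus [simp]: "abs2 (- x) = abs2 x"
proof -
  have "abs2 (-1) * abs2 (-1) = 1"
    using abs2_mult[of "-1" "-1"] by simp
  then have "abs2 (-1) = 1"
    using abs2_nonneg[of "-1"] by (metis abs_of_nonneg abs_square_eq_1 power2_eq_square)
  then show ?thesis
    using abs2_mult[of "-1" x] by simp
qed

lemma abs2_diff_commute: "abs2 (x - y) = abs2 (y - x)"
  using abs2_minus[of "x - y"] by simp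

lemma abs2_inverse: "abs2 (inverse x) = inverse (abs2 x)"
proof (cases "x = 0")
  case False
  then have "abs2 x * abs2 (inverse x) = 1"
    by (simp flip: abs2_mult)
  then show ?thesis
    by (metis inverse_unique)
qed auto

lemma abs2_add_max: "abs2 (x + y) \<le> max (abs2 x) (abs2 y)"
proof (cases "x = 0 \<or> y = 0 \<or> x + y = 0")
  case True
  then show ?thesis
    by (auto simp: le_max_iff_disj)
next
  case False
  obtain a b where x: "x = of_int a / of_int b" "b \<noteq> 0" by (rule rat_fracE)
  obtain c d where y: "y = of_int c / of_int d" "d \<noteq> 0" by (rule rat_fracE)
  define a' c' e where "a' = a * d" and "c' = c * b" and "e = b * d"
  have e: "e \<noteq> 0" and x': "x = of_int a' / of_int e" and y': "y = of_int c' / of_int e"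
    using x y by (auto simp: a'_def c'_def e_def)
  have xy': "x + y = of_int (a' + c') / of_int e"
    by (simp add: x' y' add_divide_distrib)
  have nz: "a' \<noteq> 0" "c' \<noteq> 0" "a' + c' \<noteq> 0"
    using False x' y' xy' by (metis divide_eq_0_iff of_int_eq_0_iff)+
  let ?m = "min (multiplicity 2 a') (multiplicity 2 c')"
  have "2 ^ ?m dvd a' + c'"
    by (intro dvd_add multiplicity_dvd') auto
  then have "?m \<le> multiplicity 2 (a' + c')"
    using nz by (intro multiplicity_geI) auto
  then have "int (multiplicity 2 e) - int (multiplicity 2 (a' + c'))
      \<le> max (int (multiplicity 2 e) - int (multiplicity 2 a'))
            (int (multiplicity 2 e) - int (multiplicity 2 c'))"
    by auto
  then have "abs2 (x + y) \<le> 2 powi max (int (multiplicity 2 e) - int (multiplicity 2 a'))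
            (int (multiplicity 2 e) - int (multiplicity 2 c'))"
    unfolding xy' abs2_frac[OF nz(3) e] by (intro power_int_increasing) auto
  also have "\<dots> \<le> max (abs2 x) (abs2 y)"
    unfolding x' y' abs2_frac[OF nz(1) e] abs2_frac[OF nz(2) e] by (auto simp: max_def)
  finally show ?thesis .
qed

lemma abs2_triangle: "abs2 (x + y) \<le> abs2 x + abs2 y"
  using abs2_add_max[of x y] abs2_nonneg[of x] abs2_nonneg[of y] by linarith

lemma abs2_diff_triangle: "abs2 (x - z) \<le> abs2 (x - y) + abs2 (y - z)"
  using abs2_triangle[of "x - y" "y - z"] by simp

lemma abs2_reverse_triangle: "\<bar>abs2 x - abs2 y\<bar> \<le> abs2 (x - y)"
  using abs2_triangle[of "x - y" y] abs2_triangle[of "y - x" x] abs2_diff_commute[of x y]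
  by simp


section \<open>Cauchy sequences and null sequences for the 2-adic absolute value\<close>

definition cauchy2 :: "(nat \<Rightarrow> rat) \<Rightarrow> bool" where
  "cauchy2 X \<longleftrightarrow> (\<forall>e>0. \<exists>N. \<forall>m\<ge>N. \<forall>n\<ge>N. abs2 (X m - X n) < e)"

definition null2 :: "(nat \<Rightarrow> rat) \<Rightarrow> bool" where
  "null2 X \<longleftrightarrow> (\<lambda>n. abs2 (X n)) \<longlonglongrightarrow> 0"

lemma null2_bound:
  assumes "g \<longlonglongrightarrow> 0" "eventually (\<lambda>n. abs2 (X n) \<le> g n) sequentially"
  shows "null2 X"
  unfolding null2_def
  by (rule tendsto_sandwich[OF _ assms(2) tendsto_const assms(1)]) simp

lemma null2_zero [simp]: "null2 (\<lambda>n. 0)"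
  by (simp add: null2_def)

lemma null2_add: "null2 X \<Longrightarrow> null2 Y \<Longrightarrow> null2 (\<lambda>n. X n + Y n)"
  by (rule null2_bound[where g = "\<lambda>n. abs2 (X n) + abs2 (Y n)"])
     (auto simp: null2_def abs2_triangle intro: tendsto_add_zero)

lemma null2_minus: "null2 X \<Longrightarrow> null2 (\<lambda>n. - X n)"
  by (simp add: null2_def)

lemma cauchy2_const [simp]: "cauchy2 (\<lambda>n. c)"
  by (simp add: cauchy2_def)

lemma cauchy2_minus [simp]: "cauchy2 X \<Longrightarrow> cauchy2 (\<lambda>n. - X n)"
  unfolding cauchy2_def using abs2_minus by (metis minus_diff_minus)

lemma cauchy2_add [simp]:
  assumes "cauchy2 X" "cauchy2 Y" shows "cauchy2 (\<lambda>n. X n + Y n)"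
  unfolding cauchy2_def
proof (intro allI impI)
  fix e :: real assume "e > 0"
  obtain N where N: "\<And>m n. m \<ge> N \<Longrightarrow> n \<ge> N \<Longrightarrow> abs2 (X m - X n) < e"
    using assms(1) \<open>e > 0\<close> unfolding cauchy2_def by meson
  obtain M where M: "\<And>m n. m \<ge> M \<Longrightarrow> n \<ge> M \<Longrightarrow> abs2 (Y m - Y n) < e"
    using assms(2) \<open>e > 0\<close> unfolding cauchy2_def by meson
  have "abs2 ((X m + Y m) - (X n + Y n)) < e" if "m \<ge> max N M" "n \<ge> max N M" for m n
    using abs2_add_max[of "X m - X n" "Y m - Y n"] N[of m n] M[of m n] that
    by (simp add: add_diff_add)
  then show "\<exists>N. \<forall>m\<ge>N. \<forall>n\<ge>N. abs2 ((X m + Y m) - (X n + Y n)) < e"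
    by blast
qed

lemma cauchy2_convergent_abs:
  assumes "cauchy2 X" shows "convergent (\<lambda>n. abs2 (X n))"
proof -
  have "Cauchy (\<lambda>n. abs2 (X n))"
    unfolding Cauchy_def dist_real_def
    using assms abs2_reverse_triangle unfolding cauchy2_def by (meson order_le_less_trans)
  then show ?thesis
    by (simp add: Cauchy_convergent_iff)
qed

lemma cauchy2_bounded:
  assumes "cauchy2 X" obtains B where "B > 0" "\<And>n. abs2 (X n) \<le> B"
proof -
  have "Bseq (\<lambda>n. abs2 (X n))"
    by (rule convergent_imp_Bseq[OF cauchy2_convergent_abs[OF assms]])
  then show ?thesis
    using that by (auto simp: Bseq_def)
qed

lemma cauchy2_mult [simp]:
  assumes "cauchy2 X" "cauchy2 Y" shows "cauchy2 (\<lambda>n. X n * Y n)"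
  unfolding cauchy2_def
proof (intro allI impI)
  fix e :: real assume "e > 0"
  obtain B where B: "B > 0" "\<And>n. abs2 (X n) \<le> B" by (rule cauchy2_bounded[OF assms(1)]) blast
  obtain C where C: "C > 0" "\<And>n. abs2 (Y n) \<le> C" by (rule cauchy2_bounded[OF assms(2)]) blast
  obtain N where N: "\<And>m n. m \<ge> N \<Longrightarrow> n \<ge> N \<Longrightarrow> abs2 (X m - X n) < e / C"
    using assms(1) \<open>e > 0\<close> C unfolding cauchy2_def by (meson divide_pos_pos)
  obtain M where M: "\<And>m n. m \<ge> M \<Longrightarrow> n \<ge> M \<Longrightarrow> abs2 (Y m - Y n) < e / B"
    using assms(2) \<open>e > 0\<close> B unfolding cauchy2_def by (meson divide_pos_pos)
  have "abs2 (X m * Y m - X n * Y n) < e" if "m \<ge> max N M" "n \<ge> max N M" for m n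
  proof -
    have "abs2 (X m * (Y m - Y n)) \<le> B * abs2 (Y m - Y n)"
      unfolding abs2_mult by (intro mult_right_mono B) auto
    also have "\<dots> < e"
      using M[of m n] that B(1) by (simp add: field_simps)
    finally have 1: "abs2 (X m * (Y m - Y n)) < e" .
    have "abs2 ((X m - X n) * Y n) \<le> abs2 (X m - X n) * C"
      unfolding abs2_mult by (intro mult_left_mono C) auto
    also have "\<dots> < e"
      using N[of m n] that C(1) by (simp add: field_simps)
    finally have 2: "abs2 ((X m - X n) * Y n) < e" .
    show ?thesis
      using abs2_add_max[of "X m * (Y m - Y n)" "(X m - X n) * Y n"] 1 2
      by (simp add: algebra_simps)
  qed
  then show "\<exists>N. \<forall>m\<ge>N. \<forall>n\<ge>N. abs2 (X m * Y m - X n * Y n) < e"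
    by blast
qed

lemma null2_mult_cauchy2:
  assumes "cauchy2 X" "null2 Y" shows "null2 (\<lambda>n. X n * Y n)"
proof -
  obtain B where B: "B > 0" "\<And>n. abs2 (X n) \<le> B" by (rule cauchy2_bounded[OF assms(1)]) blast
  show ?thesis
    using assms(2)
    by (intro null2_bound[where g = "\<lambda>n. B * abs2 (Y n)"])
       (auto simp: null2_def abs2_mult intro!: tendsto_mult_right_zero mult_right_mono B always_eventually)
qed

lemma cauchy2_not_null2:
  assumes "cauchy2 X" "\<not> null2 X"
  obtains c N where "c > 0" "\<And>n. n \<ge> N \<Longrightarrow> c < abs2 (X n)"
proof -
  obtain L where L: "(\<lambda>n. abs2 (X n)) \<longlonglongrightarrow> L"
    using cauchy2_convergent_abs[OF assms(1)] by (auto simp: convergent_def)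
  have "L \<ge> 0"
    by (rule LIMSEQ_le_const[OF L]) auto
  moreover have "L \<noteq> 0"
    using L assms(2) by (auto simp: null2_def)
  ultimately have "L > 0"
    by simp
  then have "eventually (\<lambda>n. L / 2 < abs2 (X n)) sequentially"
    by (intro order_tendstoD[OF L]) simp
  then show ?thesis
    using that[of "L / 2"] \<open>L > 0\<close> by (auto simp: eventually_sequentially)
qed

lemma abs2_diff_inverse:
  assumes "c > 0" "c < abs2 x" "d > 0" "d < abs2 y"
  shows "abs2 (inverse x - inverse y) \<le> abs2 (x - y) / (c * d)"
proof -
  have "x \<noteq> 0" "y \<noteq> 0"
    using assms by auto
  then have "inverse x - inverse y = (y - x) * inverse (x * y)"
    by (simp add: field_simps)
  then have "abs2 (inverse x - inverse y) = abs2 (x - y) / (abs2 x * abs2 y)"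
    by (metis abs2_mult abs2_inverse abs2_diff_commute divide_inverse)
  also have "\<dots> \<le> abs2 (x - y) / (c * d)"
    using assms by (intro divide_left_mono mult_mono mult_pos_pos) auto
  finally show ?thesis .
qed

lemma cauchy2_inverse:
  assumes "cauchy2 X" "\<not> null2 X" shows "cauchy2 (\<lambda>n. inverse (X n))"
  unfolding cauchy2_def
proof (intro allI impI)
  fix e :: real assume "e > 0"
  obtain c N where c: "c > 0" "\<And>n. n \<ge> N \<Longrightarrow> c < abs2 (X n)"
    by (rule cauchy2_not_null2[OF assms]) blast
  obtain M where M: "\<And>m n. m \<ge> M \<Longrightarrow> n \<ge> M \<Longrightarrow> abs2 (X m - X n) < e * (c * c)"
    using assms(1) \<open>e > 0\<close> c unfolding cauchy2_def by (meson mult_pos_pos)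
  have "abs2 (inverse (X m) - inverse (X n)) < e" if "m \<ge> max N M" "n \<ge> max N M" for m n
  proof -
    have "abs2 (inverse (X m) - inverse (X n)) \<le> abs2 (X m - X n) / (c * c)"
      using that by (intro abs2_diff_inverse c) auto
    also have "\<dots> < e"
      using M[of m n] that c(1) by (simp add: pos_divide_less_eq)
    finally show ?thesis .
  qed
  then show "\<exists>N. \<forall>m\<ge>N. \<forall>n\<ge>N. abs2 (inverse (X m) - inverse (X n)) < e"
    by blast
qed

lemma null2_diff_inverse:
  assumes X: "cauchy2 X" "\<not> null2 X" and Y: "cauchy2 Y" "\<not> null2 Y"
    and XY: "null2 (\<lambda>n. X n - Y n)"
  shows "null2 (\<lambda>n. inverse (X n) - inverse (Y n))"
proof -
  obtain c N where c: "c > 0" "\<And>n. n \<ge> N \<Longrightarrow> c < abs2 (X n)"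
    by (rule cauchy2_not_null2[OF X]) blast
  obtain d M where d: "d > 0" "\<And>n. n \<ge> M \<Longrightarrow> d < abs2 (Y n)"
    by (rule cauchy2_not_null2[OF Y]) blast
  show ?thesis
  proof (rule null2_bound)
    show "(\<lambda>n. abs2 (X n - Y n) / (c * d)) \<longlonglongrightarrow> 0"
      using XY unfolding null2_def by (rule tendsto_divide_zero)
    show "\<forall>\<^sub>F n in sequentially. abs2 (inverse (X n) - inverse (Y n)) \<le> abs2 (X n - Y n) / (c * d)"
      using c d by (auto simp: eventually_sequentially intro!: exI[of _ "max N M"] abs2_diff_inverse)
  qed
qed


section \<open>The field of 2-adic numbers as the completion of the rationals\<close>

definition padic2_rel :: "(nat \<Rightarrow> rat) \<Rightarrow> (nat \<Rightarrow> rat) \<Rightarrow> bool" where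
  "padic2_rel X Y \<longleftrightarrow> cauchy2 X \<and> cauchy2 Y \<and> null2 (\<lambda>n. X n - Y n)"

lemma padic2_rel_refl: "cauchy2 X \<Longrightarrow> padic2_rel X X"
  by (simp add: padic2_rel_def)

lemma part_equivp_padic2_rel: "part_equivp padic2_rel"
proof (rule part_equivpI)
  show "\<exists>X. padic2_rel X X"
    using padic2_rel_refl cauchy2_const by blast
  show "symp padic2_rel"
    by (auto simp: symp_def padic2_rel_def null2_def abs2_diff_commute)
  show "transp padic2_rel"
  proof (rule transpI)
    fix X Y Z assume "padic2_rel X Y" "padic2_rel Y Z"
    then show "padic2_rel X Z"
      using null2_add[of "\<lambda>n. X n - Y n" "\<lambda>n. Y n - Z n"] by (simp add: padic2_rel_def)
  qed
qed

quotient_type padic2 = "nat \<Rightarrow> rat" / partial: padic2_rel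
  morphisms rep_padic2 Padic2
  by (rule part_equivp_padic2_rel)

lemma cr_padic2_eq: "pcr_padic2 = (\<lambda>x y. cauchy2 x \<and> Padic2 x = y)"
  unfolding padic2.pcr_cr_eq cr_padic2_def padic2_rel_def by auto

lemma Padic2_induct [case_names Padic2, induct type: padic2]:
  assumes "\<And>X. cauchy2 X \<Longrightarrow> P (Padic2 X)"
  shows "P x"
proof (induct x)
  case (1 X)
  then show ?case
    by (simp add: padic2_rel_def assms)
qed

lemma Padic2_eq_iff:
  "cauchy2 X \<Longrightarrow> cauchy2 Y \<Longrightarrow> Padic2 X = Padic2 Y \<longleftrightarrow> null2 (\<lambda>n. X n - Y n)"
  using padic2.rel_eq_transfer
  unfolding padic2.pcr_cr_eq cr_padic2_def rel_fun_def padic2_rel_def by simp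

lemma Domainp_pcr_padic2 [transfer_domain_rule]: "Domainp pcr_padic2 = cauchy2"
  by (auto simp: padic2.domain_eq padic2_rel_def)

instantiation padic2 :: field
begin

lift_definition zero_padic2 :: padic2 is "\<lambda>n. 0"
  by (simp add: padic2_rel_refl)

lift_definition one_padic2 :: padic2 is "\<lambda>n. 1"
  by (simp add: padic2_rel_refl)

lift_definition plus_padic2 :: "padic2 \<Rightarrow> padic2 \<Rightarrow> padic2" is "\<lambda>X Y n. X n + Y n"
  unfolding padic2_rel_def add_diff_add by (simp add: null2_add)

lift_definition uminus_padic2 :: "padic2 \<Rightarrow> padic2" is "\<lambda>X n. - X n"
  unfolding padic2_rel_def minus_diff_minus by (simp only: cauchy2_minus null2_minus simp_thms)

lift_definition times_padic2 :: "padic2 \<Rightarrow> padic2 \<Rightarrow> padic2" is "\<lambda>X Y n. X n * Y n"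
proof -
  fix X X' Y Y' assume "padic2_rel X X'" "padic2_rel Y Y'"
  then have *: "cauchy2 X" "cauchy2 X'" "cauchy2 Y" "cauchy2 Y'"
      "null2 (\<lambda>n. X n - X' n)" "null2 (\<lambda>n. Y n - Y' n)"
    by (simp_all add: padic2_rel_def)
  then have "null2 (\<lambda>n. X n * (Y n - Y' n) + Y' n * (X n - X' n))"
    by (intro null2_add null2_mult_cauchy2)
  then show "padic2_rel (\<lambda>n. X n * Y n) (\<lambda>n. X' n * Y' n)"
    using * by (simp add: padic2_rel_def algebra_simps)
qed

lift_definition inverse_padic2 :: "padic2 \<Rightarrow> padic2"
  is "\<lambda>X. if null2 X then (\<lambda>n. 0) else (\<lambda>n. inverse (X n))"
proof -
  fix X Y assume "padic2_rel X Y"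
  then have *: "cauchy2 X" "cauchy2 Y" "null2 (\<lambda>n. X n - Y n)"
    by (simp_all add: padic2_rel_def)
  have "null2 X \<longleftrightarrow> null2 Y"
    using null2_add[of Y "\<lambda>n. X n - Y n"] null2_add[of X "\<lambda>n. - (X n - Y n)"] null2_minus[OF *(3)] *
    by auto
  then show "padic2_rel (if null2 X then (\<lambda>n. 0) else (\<lambda>n. inverse (X n)))
      (if null2 Y then (\<lambda>n. 0) else (\<lambda>n. inverse (Y n)))"
    using * by (simp add: padic2_rel_def cauchy2_inverse null2_diff_inverse)
qed

definition "x - y = x + - y" for x y :: padic2

definition "x div y = x * inverse y" for x y :: padic2

instance
proof
  fix a b c :: padic2
  show "a + b = b + a"
    by transfer (simp add: ac_simps padic2_rel_refl)
  show "(a + b) + c = a + (b + c)"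
    by transfer (simp add: ac_simps padic2_rel_refl)
  show "0 + a = a"
    by transfer (simp add: padic2_rel_refl)
  show "- a + a = 0"
    by transfer (simp add: padic2_rel_refl)
  show "a - b = a + - b"
    by (rule minus_padic2_def)
  show "(a * b) * c = a * (b * c)"
    by transfer (simp add: ac_simps padic2_rel_refl)
  show "a * b = b * a"
    by transfer (simp add: ac_simps padic2_rel_refl)
  show "1 * a = a"
    by transfer (simp add: padic2_rel_refl)
  show "(a + b) * c = a * c + b * c"
    by transfer (simp add: distrib_right padic2_rel_refl)
  show "(0 :: padic2) \<noteq> 1"
    by transfer (simp add: padic2_rel_def null2_def LIMSEQ_const_iff)
  show "inverse a * a = 1" if "a \<noteq> 0"
    using that
  proof transfer
    fix X assume X: "cauchy2 X" "\<not> padic2_rel X (\<lambda>n. 0)"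
    then have nn: "\<not> null2 X"
      by (simp add: padic2_rel_def)
    obtain c N where c: "c > 0" "\<And>n. n \<ge> N \<Longrightarrow> c < abs2 (X n)"
      by (rule cauchy2_not_null2[OF X(1) nn]) blast
    have "inverse (X n) * X n - 1 = 0" if "n \<ge> N" for n
    proof -
      have "X n \<noteq> 0"
        using c(1) c(2)[OF that] by auto
      then show ?thesis
        by simp
    qed
    then have "null2 (\<lambda>n. inverse (X n) * X n - 1)"
      by (intro null2_bound[where g = "\<lambda>_. 0"] eventually_sequentiallyI[of N]) simp_all
    then show "padic2_rel (\<lambda>n. (if null2 X then \<lambda>n. 0 else (\<lambda>n. inverse (X n))) n * X n) (\<lambda>n. 1)"
      unfolding padic2_rel_def if_not_P[OF nn]
      by (intro conjI cauchy2_mult cauchy2_inverse cauchy2_const X(1) nn)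
  qed
  show "a div b = a * inverse b"
    by (rule divide_padic2_def)
  show "inverse (0 :: padic2) = 0"
    by transfer (simp add: padic2_rel_refl)
qed

end

lemma of_nat_Padic2: "of_nat k = Padic2 (\<lambda>n. of_nat k)"
proof (induction k)
  case 0
  show ?case
    by (simp add: zero_padic2_def)
next
  case (Suc k)
  have "1 + Padic2 (\<lambda>n. of_nat k) = Padic2 (\<lambda>n. 1 + of_nat k)"
    using plus_padic2.transfer one_padic2.transfer
    by (simp add: cr_padic2_eq rel_fun_def one_padic2_def)
  then show ?case
    by (simp add: Suc)
qed

instance padic2 :: field_char_0
proof
  show "inj (of_nat :: nat \<Rightarrow> padic2)"
    by (rule injI) (simp add: of_nat_Padic2 Padic2_eq_iff null2_def LIMSEQ_const_iff)
qed

lemma minus_Padic2: "cauchy2 X \<Longrightarrow> - Padic2 X = Padic2 (\<lambda>n. - X n)"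
  using uminus_padic2.transfer by (simp add: cr_padic2_eq rel_fun_def)

lemma add_Padic2: "cauchy2 X \<Longrightarrow> cauchy2 Y \<Longrightarrow> Padic2 X + Padic2 Y = Padic2 (\<lambda>n. X n + Y n)"
  using plus_padic2.transfer by (simp add: cr_padic2_eq rel_fun_def)

lemma diff_Padic2: "cauchy2 X \<Longrightarrow> cauchy2 Y \<Longrightarrow> Padic2 X - Padic2 Y = Padic2 (\<lambda>n. X n - Y n)"
  by (simp add: minus_Padic2 add_Padic2 minus_padic2_def)

lemma mult_Padic2: "cauchy2 X \<Longrightarrow> cauchy2 Y \<Longrightarrow> Padic2 X * Padic2 Y = Padic2 (\<lambda>n. X n * Y n)"
  using times_padic2.transfer by (simp add: cr_padic2_eq rel_fun_def)

lemma of_int_Padic2: "of_int k = Padic2 (\<lambda>n. of_int k)"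
  by (cases k rule: int_diff_cases) (simp add: of_nat_Padic2 diff_Padic2)

lemma of_rat_Padic2: "of_rat r = Padic2 (\<lambda>n. r)"
proof -
  obtain a b where r: "r = of_int a / of_int b" "b \<noteq> 0"
    by (rule rat_fracE)
  have "Padic2 (\<lambda>n. r) * of_int b = of_int a"
    using r by (simp add: of_int_Padic2 mult_Padic2)
  moreover have "of_rat r = (of_int a / of_int b :: padic2)"
    by (simp add: r of_rat_divide)
  ultimately have "of_rat r = Padic2 (\<lambda>n. r) * of_int b / of_int b"
    by simp
  also have "\<dots> = Padic2 (\<lambda>n. r)"
    using r(2) by simp
  finally show ?thesis .
qed


section \<open>The 2-adic absolute value and metric\<close>

lift_definition padic2_abs :: "padic2 \<Rightarrow> real" is "\<lambda>X. lim (\<lambda>n. abs2 (X n))"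
proof -
  fix X Y assume "padic2_rel X Y"
  then have *: "cauchy2 X" "cauchy2 Y" "null2 (\<lambda>n. X n - Y n)"
    by (simp_all add: padic2_rel_def)
  have "(\<lambda>n. abs2 (X n) - abs2 (Y n)) \<longlonglongrightarrow> 0"
    by (rule Lim_null_comparison[OF _ *(3)[unfolded null2_def]]) (simp add: abs2_reverse_triangle)
  moreover have "(\<lambda>n. abs2 (Y n)) \<longlonglongrightarrow> lim (\<lambda>n. abs2 (Y n))"
    using cauchy2_convergent_abs[OF *(2)] by (simp add: convergent_LIMSEQ_iff)
  ultimately have "(\<lambda>n. abs2 (X n)) \<longlonglongrightarrow> lim (\<lambda>n. abs2 (Y n))"
    using tendsto_add by fastforce
  then show "lim (\<lambda>n. abs2 (X n)) = lim (\<lambda>n. abs2 (Y n))"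
    by (rule limI)
qed

lemma padic2_abs_Padic2:
  assumes "cauchy2 X" shows "(\<lambda>n. abs2 (X n)) \<longlonglongrightarrow> padic2_abs (Padic2 X)"
proof -
  have "padic2_abs (Padic2 X) = lim (\<lambda>n. abs2 (X n))"
    using padic2_abs.transfer assms by (simp add: cr_padic2_eq rel_fun_def)
  then show ?thesis
    using cauchy2_convergent_abs[OF assms] by (simp add: convergent_LIMSEQ_iff)
qed

lemma padic2_abs_of_rat [simp]: "padic2_abs (of_rat r) = abs2 r"
  using padic2_abs_Padic2[of "\<lambda>n. r"] by (simp add: of_rat_Padic2 LIMSEQ_const_iff)

lemma padic2_abs_nonneg [simp]: "0 \<le> padic2_abs x"
proof (induct x)
  case (Padic2 X)
  then show ?case
    by (intro LIMSEQ_le_const[OF padic2_abs_Padic2]) auto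
qed

lemma padic2_abs_eq_0_iff [simp]: "padic2_abs x = 0 \<longleftrightarrow> x = 0"
proof (induct x)
  case (Padic2 X)
  have "padic2_abs (Padic2 X) = 0 \<longleftrightarrow> null2 X"
    using padic2_abs_Padic2[OF Padic2] LIMSEQ_unique by (auto simp: null2_def)
  also have "\<dots> \<longleftrightarrow> Padic2 X = 0"
    using Padic2_eq_iff[OF Padic2 cauchy2_const[of 0]] by (simp add: zero_padic2_def)
  finally show ?case .
qed

lemma padic2_abs_mult: "padic2_abs (x * y) = padic2_abs x * padic2_abs y"
proof (induct x)
  case X: (Padic2 X)
  show ?case
  proof (induct y)
    case Y: (Padic2 Y)
    have "(\<lambda>n. abs2 (X n * Y n)) \<longlonglongrightarrow> padic2_abs (Padic2 X) * padic2_abs (Padic2 Y)"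
      unfolding abs2_mult by (intro tendsto_mult padic2_abs_Padic2 X Y)
    moreover have "(\<lambda>n. abs2 (X n * Y n)) \<longlonglongrightarrow> padic2_abs (Padic2 X * Padic2 Y)"
      using X Y by (simp add: mult_Padic2 padic2_abs_Padic2)
    ultimately show ?case
      by (rule LIMSEQ_unique[rotated])
  qed
qed

lemma padic2_abs_minus [simp]: "padic2_abs (- x) = padic2_abs x"
  using padic2_abs_mult[of "of_rat (-1)" x] padic2_abs_of_rat[of "-1"]
  by (simp add: of_rat_minus del: padic2_abs_of_rat)

lemma padic2_abs_add_max: "padic2_abs (x + y) \<le> max (padic2_abs x) (padic2_abs y)"
proof (induct x)
  case X: (Padic2 X)
  show ?case
  proof (induct y)
    case Y: (Padic2 Y)
    have "(\<lambda>n. abs2 (X n + Y n)) \<longlonglongrightarrow> padic2_abs (Padic2 X + Padic2 Y)"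
      using X Y by (simp add: add_Padic2 padic2_abs_Padic2)
    moreover have "(\<lambda>n. max (abs2 (X n)) (abs2 (Y n)))
        \<longlonglongrightarrow> max (padic2_abs (Padic2 X)) (padic2_abs (Padic2 Y))"
      by (intro tendsto_max padic2_abs_Padic2 X Y)
    ultimately show ?case
      by (rule LIMSEQ_le) (simp add: abs2_add_max)
  qed
qed

lemma padic2_abs_triangle: "padic2_abs (x + y) \<le> padic2_abs x + padic2_abs y"
  using padic2_abs_add_max[of x y] padic2_abs_nonneg[of x] padic2_abs_nonneg[of y] by linarith

instantiation padic2 :: metric_space
begin

definition "dist x y = padic2_abs (x - y)" for x y :: padic2

definition "uniformity = (INF e\<in>{0<..}. principal {(x :: padic2, y). dist x y < e})"

definition "open U = (\<forall>x\<in>U. eventually (\<lambda>(x', y). x' = x \<longrightarrow> y \<in> U) uniformity)"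
  for U :: "padic2 set"

instance
proof
  fix x y z :: padic2
  show "dist x y = 0 \<longleftrightarrow> x = y"
    by (simp add: dist_padic2_def)
  show "dist x y \<le> dist x z + dist y z"
    using padic2_abs_triangle[of "x - z" "- (y - z)"] by (simp add: dist_padic2_def del: minus_diff_eq)
qed (simp_all add: uniformity_padic2_def open_padic2_def)

end

lemma Padic2_tendsto:
  assumes "cauchy2 X" shows "(\<lambda>n. of_rat (X n)) \<longlonglongrightarrow> Padic2 X"
proof (rule metric_LIMSEQ_I)
  fix e :: real assume "e > 0"
  obtain N where N: "\<And>m n. m \<ge> N \<Longrightarrow> n \<ge> N \<Longrightarrow> abs2 (X m - X n) < e / 2"
    using assms \<open>e > 0\<close> unfolding cauchy2_def by (meson half_gt_zero)
  have "dist (of_rat (X n)) (Padic2 X) < e" if "n \<ge> N" for n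
  proof -
    have "cauchy2 (\<lambda>m. X n - X m)"
      using cauchy2_add[OF cauchy2_const[of "X n"] cauchy2_minus[OF assms]] by simp
    then have "(\<lambda>m. abs2 (X n - X m)) \<longlonglongrightarrow> dist (of_rat (X n)) (Padic2 X)"
      using padic2_abs_Padic2[of "\<lambda>m. X n - X m"] assms
      by (simp add: dist_padic2_def of_rat_Padic2 diff_Padic2)
    then have "dist (of_rat (X n)) (Padic2 X) \<le> e / 2"
      using N[OF that] by (intro LIMSEQ_le_const2) (auto intro: less_imp_le)
    then show ?thesis
      using \<open>e > 0\<close> by linarith
  qed
  then show "\<exists>N. \<forall>n\<ge>N. dist (of_rat (X n)) (Padic2 X) < e"
    by blast
qed

lemma padic2_rat_dense:
  fixes x :: padic2 assumes "e > 0" shows "\<exists>r. dist (of_rat r) x < e"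
proof (induct x)
  case (Padic2 X)
  show ?case
    using metric_LIMSEQ_D[OF Padic2_tendsto[OF Padic2] assms] by blast
qed

instance padic2 :: complete_space
proof
  fix x :: "nat \<Rightarrow> padic2" assume "Cauchy x"
  have "\<forall>n. \<exists>r. dist (of_rat r) (x n) < inverse (real (Suc n))"
    by (intro allI padic2_rat_dense) simp
  then obtain R where R: "\<And>n. dist (of_rat (R n)) (x n) < inverse (real (Suc n))"
    by metis
  have "(\<lambda>n. dist (of_rat (R n)) (x n)) \<longlonglongrightarrow> 0"
    by (rule tendsto_sandwich[OF _ _ tendsto_const LIMSEQ_inverse_real_of_nat])
       (auto intro!: always_eventually less_imp_le R simp del: of_nat_Suc)
  have "cauchy2 R"
    unfolding cauchy2_def
  proof (intro allI impI)
    fix e :: real assume "e > 0"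
    then have e: "e / 3 > 0"
      by simp
    obtain N where N: "\<And>n. n \<ge> N \<Longrightarrow> dist (of_rat (R n)) (x n) < e / 3"
      using order_tendstoD(2)[OF \<open>_ \<longlonglongrightarrow> 0\<close> e] by (auto simp: eventually_sequentially)
    obtain M where M: "\<And>m n. m \<ge> M \<Longrightarrow> n \<ge> M \<Longrightarrow> dist (x m) (x n) < e / 3"
      using metric_CauchyD[OF \<open>Cauchy x\<close> e] by blast
    have "abs2 (R m - R n) < e" if "m \<ge> max N M" "n \<ge> max N M" for m n
    proof -
      have "abs2 (R m - R n) = dist (of_rat (R m)) (of_rat (R n) :: padic2)"
        by (simp add: dist_padic2_def flip: of_rat_diff)
      also have "\<dots> \<le> dist (of_rat (R m)) (x m) + dist (x m) (x n) + dist (of_rat (R n)) (x n)"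
        using dist_triangle[of "of_rat (R m)" "of_rat (R n)" "x m"]
          dist_triangle[of "x m" "of_rat (R n)" "x n"] dist_commute[of "x n" "of_rat (R n)"]
        by linarith
      also have "\<dots> < e"
        using N[of m] N[of n] M[of m n] that by simp
      finally show ?thesis .
    qed
    then show "\<exists>N. \<forall>m\<ge>N. \<forall>n\<ge>N. abs2 (R m - R n) < e"
      by blast
  qed
  have "(\<lambda>n. dist (x n) (Padic2 R)) \<longlonglongrightarrow> 0"
  proof (rule tendsto_sandwich[OF _ _ tendsto_const])
    show "(\<lambda>n. dist (of_rat (R n)) (x n) + dist (of_rat (R n)) (Padic2 R)) \<longlonglongrightarrow> 0"
      by (rule tendsto_add_zero[OF \<open>_ \<longlonglongrightarrow> 0\<close>
          iffD1[OF tendsto_dist_iff Padic2_tendsto[OF \<open>cauchy2 R\<close>]]])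
  qed (simp_all add: dist_triangle3)
  then have "x \<longlonglongrightarrow> Padic2 R"
    by (rule iffD2[OF tendsto_dist_iff])
  then show "convergent x"
    by (auto simp: convergent_def)
qed


section \<open>The space K and the set \<open>\<F>\<close>\<close>

type_synonym K = "real \<times> padic2"

definition dK :: "K \<Rightarrow> K \<Rightarrow> real" where
  "dK x y = max \<bar>fst x - fst y\<bar> (padic2_abs (snd x - snd y))"

definition K_topology :: "K topology" where
  "K_topology = Metric_space.mtopology UNIV dK"

definition scaleK :: "rat \<Rightarrow> K \<Rightarrow> K" where
  "scaleK \<alpha> x = (of_rat \<alpha> * fst x, of_rat \<alpha> * snd x)"

definition \<phi> :: "rat \<Rightarrow> K" where
  "\<phi> z = (of_rat z, of_rat z)"

text \<open>
  The product type carries the Euclidean combination of the two component metrics rather than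
  the maximum \<^const>\<open>dK\<close>. The two induce the same topology, so limits and infinite sums
  in \<^typ>\<open>K\<close> (such as the one in \<open>\<F>\<close> below) may be read with respect to either.
\<close>

lemma Metric_space_dK: "Metric_space UNIV dK"
proof
  fix x y z :: K
  have *: "dK x y = max (dist (fst x) (fst y)) (dist (snd x) (snd y))" for x y
    by (simp add: dK_def dist_real_def dist_padic2_def)
  show "0 \<le> dK x y"
    by (simp add: * le_max_iff_disj)
  show "dK x y = dK y x"
    by (simp add: * dist_commute)
  show "dK x y = 0 \<longleftrightarrow> x = y"
    by (auto simp: * max_def prod_eq_iff)
  show "dK x z \<le> dK x y + dK y z"
    unfolding * using dist_triangle[of "fst x" "fst z" "fst y"]
      dist_triangle[of "snd x" "snd z" "snd y"] by linarith
qed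

lemma K_topology_eq_euclidean: "K_topology = euclidean"
proof -
  interpret Metric_space UNIV dK
    by (rule Metric_space_dK)
  have dK: "dK x y = max (dist (fst x) (fst y)) (dist (snd x) (snd y))" for x y
    by (simp add: dK_def dist_real_def dist_padic2_def)
  have le: "dK x y \<le> dist x y" for x y
    unfolding dK using dist_fst_le[of x y] dist_snd_le[of x y] by simp
  have ge: "dist x y \<le> 2 * dK x y" for x y
  proof -
    have "dist x y \<le> dist (fst x) (fst y) + dist (snd x) (snd y)"
      unfolding dist_prod_def by (rule sqrt_sum_squares_le_sum) auto
    then show ?thesis
      unfolding dK by linarith
  qed
  have iff: "(\<exists>r>0. mball x r \<subseteq> U) \<longleftrightarrow> (\<exists>r>0. ball x r \<subseteq> U)" for x U
  proof
    assume "\<exists>r>0. mball x r \<subseteq> U"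
    then obtain r where "r > 0" "mball x r \<subseteq> U" by blast
    moreover have "ball x r \<subseteq> mball x r"
    proof
      fix y assume "y \<in> ball x r"
      then show "y \<in> mball x r"
        using le[of x y] by (simp add: in_mball)
    qed
    ultimately show "\<exists>r>0. ball x r \<subseteq> U"
      by blast
  next
    assume "\<exists>r>0. ball x r \<subseteq> U"
    then obtain r where r: "r > 0" "ball x r \<subseteq> U" by blast
    have "mball x (r / 2) \<subseteq> ball x r"
    proof
      fix y assume "y \<in> mball x (r / 2)"
      then show "y \<in> ball x r"
        using ge[of x y] by (simp add: in_mball)
    qed
    then show "\<exists>r>0. mball x r \<subseteq> U"
      using r by (intro exI[of _ "r / 2"]) auto
  qed
  have "openin mtopology U \<longleftrightarrow> open U" for U
    unfolding openin_mtopology open_contains_ball Ball_def iff by simp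
  then show ?thesis
    unfolding K_topology_def by (simp add: topology_eq)
qed

text \<open>
  Infinite sums start at \<open>0\<close>, hence the index shift; \<open>d i\<close> is the digit belonging to the
  exponent \<open>-i\<close>. The sum always converges, see \<open>summable_F\<close> below.
\<close>

definition \<F> :: "K set" where
  "\<F> = {scaleK (1 / 2) (\<Sum>i. scaleK ((- 3 / 2) powi (- int (Suc i))) (\<phi> (d (Suc i)))) | d :: nat \<Rightarrow> rat.
          \<forall>i\<ge>1. d i \<in> {0, 1, 2}}"

lemma summable_padic2I:
  assumes "\<And>i. padic2_abs (f i) \<le> (1 / 2) ^ i"
  shows "summable f"
proof -
  have bound: "padic2_abs (\<Sum>i<m + k. f i - (if i < m then f i else 0)) \<le> (1 / 2) ^ m" for m k
  proof (induction k)
    case 0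
    have "(\<Sum>i<m. f i - (if i < m then f i else 0)) = 0"
      by (intro sum.neutral) auto
    then show ?case
      by (simp only: add_0_right padic2_abs_eq_0_iff[THEN iffD2]) simp
  next
    case (Suc k)
    have "padic2_abs (f (m + k)) \<le> (1 / 2) ^ m"
      by (rule order_trans[OF assms power_decreasing]) auto
    then show ?case
      using Suc.IH padic2_abs_add_max[of "\<Sum>i<m + k. f i - (if i < m then f i else 0)" "f (m + k)"]
      by simp
  qed
  have dist: "dist (\<Sum>i<m. f i) (\<Sum>i<n. f i) \<le> (1 / 2) ^ m" if "m \<le> n" for m n
  proof -
    have "(\<Sum>i<n. if i < m then f i else 0) = (\<Sum>i<m. f i)"
      using that by (intro sum.mono_neutral_cong_right) auto
    then have "dist (\<Sum>i<n. f i) (\<Sum>i<m. f i) \<le> (1 / 2) ^ m"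
      using bound[of m "n - m"] that by (simp add: dist_padic2_def sum_subtractf)
    then show ?thesis
      by (simp only: dist_commute)
  qed
  have "Cauchy (\<lambda>n. \<Sum>i<n. f i)"
  proof (rule metric_CauchyI)
    fix e :: real assume "e > 0"
    have "(\<lambda>n. (1 / 2 :: real) ^ n) \<longlonglongrightarrow> 0"
      by (rule LIMSEQ_realpow_zero) auto
    then obtain N where N: "\<And>n. n \<ge> N \<Longrightarrow> (1 / 2 :: real) ^ n < e"
      using order_tendstoD(2)[OF _ \<open>e > 0\<close>] by (fastforce simp: eventually_sequentially)
    have "dist (\<Sum>i<m. f i) (\<Sum>i<n. f i) < e" if "m \<ge> N" "n \<ge> N" for m n
      using dist[of m n] dist[of n m] N[OF that(1)] N[OF that(2)]
        dist_commute[of "sum f {..<m}" "sum f {..<n}"]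
      by (cases "m \<le> n") auto
    then show "\<exists>N. \<forall>m\<ge>N. \<forall>n\<ge>N. dist (\<Sum>i<m. f i) (\<Sum>i<n. f i) < e"
      by blast
  qed
  then show ?thesis
    by (simp add: Cauchy_convergent_iff summable_iff_convergent)
qed

lemma summable_F:
  fixes d :: "nat \<Rightarrow> rat"
  assumes "\<forall>i\<ge>1. d i \<in> {0, 1, 2}"
  shows "summable (\<lambda>i. scaleK ((- 3 / 2) powi (- int (Suc i))) (\<phi> (d (Suc i))))"
proof -
  define t where "t i = (- 3 / 2) powi (- int (Suc i)) * d (Suc i)" for i
  have pow: "(- 3 / 2) powi (- int (Suc i)) = (- 2 / 3 :: rat) ^ Suc i" for i
  proof -
    have "(- 3 / 2) powi (- int (Suc i)) = inverse (- 3 / 2 :: rat) ^ Suc i"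
      by (simp only: power_int_minus power_int_of_nat power_inverse)
    then show ?thesis
      by (simp del: power_Suc)
  qed
  have d: "d (Suc i) \<in> {0, 1, 2}" for i
    using assms by simp
  have "summable (\<lambda>i. of_rat (t i) :: real)"
  proof (rule summable_comparison_test')
    show "summable (\<lambda>i. 2 * (2 / 3 :: real) ^ Suc i)"
      by (intro summable_mult iffD2[OF summable_Suc_iff] summable_geometric) simp
    show "norm (of_rat (t i) :: real) \<le> 2 * (2 / 3) ^ Suc i" for i
    proof -
      have "\<bar>t i\<bar> \<le> 2 * (2 / 3) ^ Suc i"
        unfolding t_def pow abs_mult power_abs using d[of i] by auto
      then have "of_rat \<bar>t i\<bar> \<le> (of_rat (2 * (2 / 3) ^ Suc i) :: real)"
        by (simp only: of_rat_less_eq)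
      then show ?thesis
        by (simp add: of_rat_mult of_rat_power of_rat_divide del: power_Suc)
    qed
  qed
  moreover have "summable (\<lambda>i. of_rat (t i) :: padic2)"
  proof (rule summable_padic2I)
    fix i
    have a3: "abs2 (- 2 / 3) = 1 / 2"
      using abs2_frac[of 2 3] multiplicity_self[of "2::int"]
        not_dvd_imp_multiplicity_0[of 2 "3::int"]
      by (simp add: power_int_minus)
    have "abs2 ((- 2 / 3) ^ n) = (1 / 2) ^ n" for n
      by (induction n) (simp, simp only: power_Suc abs2_mult a3)
    moreover have "abs2 (d (Suc i)) \<le> 1"
      using d[of i] by (auto simp: abs2_2)
    ultimately have "abs2 (t i) \<le> (1 / 2) ^ Suc i"
      unfolding t_def pow abs2_mult by (simp add: mult_left_le del: power_Suc divide_minus_left)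
    also have "\<dots> \<le> (1 / 2) ^ i"
      by simp
    finally show "padic2_abs (of_rat (t i)) \<le> (1 / 2) ^ i"
      by simp
  qed
  ultimately have "(\<lambda>n. (\<Sum>i<n. of_rat (t i) :: real, \<Sum>i<n. of_rat (t i) :: padic2))
      \<longlonglongrightarrow> (\<Sum>i. of_rat (t i), \<Sum>i. of_rat (t i))"
    by (intro tendsto_Pair summable_LIMSEQ)
  moreover have "(\<Sum>i<n. scaleK ((- 3 / 2) powi (- int (Suc i))) (\<phi> (d (Suc i))))
      = (\<Sum>i<n. of_rat (t i), \<Sum>i<n. of_rat (t i))" for n
    by (simp add: prod_eq_iff fst_sum snd_sum scaleK_def \<phi>_def t_def of_rat_mult
        del: of_nat_Suc)
  ultimately show ?thesis
    unfolding summable_def sums_def by auto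
qed

end

theory Submission
  imports Defs "HOL-Number_Theory.Cong"
begin

text \<open>
  Let \<open>D\<close> be the set of all rationals with a finite expansion. The closure of \<open>\<phi> ` D\<close> is mapped into
  itself by choosing a suitable leading digit and removing it, so each of its points has an infinite
  expansion; hence \<open>\<F>\<close> is this closure. The expansion algorithm, with digits chosen modulo 3 and
  denominators losing one factor 2 per step, reaches an integer in \<open>{-2..2}\<close> and then 0.
  Therefore every small rational of the form \<open>16 N / 3 ^ m\<close> lies in \<open>D\<close>; these are dense near \<open>0\<close>,
  which makes \<open>0\<close> an interior point. Appending digits translates and scales this neighbourhood
  to any other point of \<open>\<phi> ` D\<close>, so the dense subset \<open>\<phi> ` D\<close> of \<open>\<F>\<close> consists of interior points.
\<close>

section \<open>The 2-adic absolute value\<close>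

lemma abs2_of_int_le_1: "abs2 (of_int n) \<le> 1"
proof (cases "n = 0")
  case False
  then show ?thesis
    using abs2_frac[of n 1] by (simp add: power_int_minus inverse_le_1_iff)
qed simp

lemma abs2_odd:
  assumes "odd n"
  shows "abs2 (of_int n) = 1"
proof -
  have "n \<noteq> 0"
    using assms by auto
  then show ?thesis
    using abs2_frac[of n 1] not_dvd_imp_multiplicity_0[OF assms] by simp
qed

lemma abs2_power: "abs2 (x ^ n) = abs2 x ^ n"
  by (induction n) (simp_all add: abs2_mult)

lemma abs2_divide: "abs2 (x / y) = abs2 x / abs2 y"
  by (simp add: divide_inverse abs2_mult abs2_inverse)

lemma abs2_23: "abs2 (- 2 / 3) = 1 / 2"
  using abs2_odd[of 3] by (simp add: abs2_divide abs2_2)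

section \<open>Finite expansions\<close>

text \<open>Digits are appended at the low-order end, and \<open>c / 2\<close> carries the factor
  1/2 of \<open>\<F>\<close>. As 0 is a digit, the sets increase with \<open>k\<close>.\<close>

primrec finite_exps :: "nat \<Rightarrow> rat set" where
  "finite_exps 0 = {0}"
| "finite_exps (Suc k) = {x + (- 2 / 3) ^ Suc k * (c / 2) | x c. x \<in> finite_exps k \<and> c \<in> {0, 1, 2}}"

lemma finite_exps_SucI:
  "x \<in> finite_exps k \<Longrightarrow> c \<in> {0, 1, 2} \<Longrightarrow> y = x + (- 2 / 3) ^ Suc k * (c / 2) \<Longrightarrow> y \<in> finite_exps (Suc k)"
  by (subst finite_exps.simps) blast

lemma finite_exps_SucE:
  assumes "y \<in> finite_exps (Suc k)"
  obtains x c where "x \<in> finite_exps k" "c \<in> {0, 1, 2}" "y = x + (- 2 / 3) ^ Suc k * (c / 2)"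
  using assms unfolding finite_exps.simps(2) mem_Collect_eq by blast

text \<open>Concatenation of digit strings: \<open>(- 2 / 3) ^ k\<close> shifts the digits of
  \<open>y\<close> behind those of \<open>x\<close>. This later carries a neighbourhood of 0 to any
  finite expansion.\<close>

lemma finite_exps_append:
  assumes "x \<in> finite_exps k" "y \<in> finite_exps l"
  shows "x + (- 2 / 3) ^ k * y \<in> finite_exps (k + l)"
  using assms(2)
proof (induction l arbitrary: y)
  case 0
  then show ?case
    using assms(1) by simp
next
  case (Suc l)
  obtain z c where "z \<in> finite_exps l" "c \<in> {0, 1, 2}" "y = z + (- 2 / 3) ^ Suc l * (c / 2)"
    using finite_exps_SucE[OF Suc.prems] by blast
  moreover from this have
    "x + (- 2 / 3) ^ k * y = (x + (- 2 / 3) ^ k * z) + (- 2 / 3) ^ Suc (k + l) * (c / 2)"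
    by (simp only: distrib_left power_add mult.assoc add.assoc add_Suc_right[symmetric])
  ultimately show ?case
    using Suc.IH finite_exps_SucI unfolding add_Suc_right by blast
qed

text \<open>The recursion exposes the last digit, but infinite expansions are read off from the
  first. The induction peels off the last digit and takes the leading digit of the remaining
  prefix.\<close>

lemma finite_exps_leading_digit:
  assumes "x \<in> finite_exps (Suc k)"
  shows "\<exists>c\<in>{0, 1, 2}. (- 3 / 2) * x - c / 2 \<in> finite_exps k"
  using assms
proof (induction k arbitrary: x)
  case (Suc k)
  obtain z c where z: "z \<in> finite_exps (Suc k)" and c: "c \<in> {0, 1, 2}"
    and x: "x = z + (- 2 / 3) ^ Suc (Suc k) * (c / 2)"
    using finite_exps_SucE[OF Suc.prems] .
  obtain b where b: "b \<in> {0, 1, 2}" "(- 3 / 2) * z - b / 2 \<in> finite_exps k"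
    using Suc.IH[OF z] by blast
  have "(- 3 / 2) * x - b / 2 = ((- 3 / 2) * z - b / 2) + (- 2 / 3) ^ Suc k * (c / 2)"
  proof -
    have "(- 3 / 2) * (z + (- 2 / 3) * p * (c / 2)) - b / 2 = ((- 3 / 2) * z - b / 2) + p * (c / 2)" for p
      by (simp add: algebra_simps)
    then show ?thesis
      unfolding x power_Suc[of _ "Suc k"] .
  qed
  then show ?case
    using finite_exps_SucI[OF b(2) c] b(1) by blast
qed auto

lemma zero_in_finite_exps: "0 \<in> finite_exps k"
  by (induction k) (simp, rule finite_exps_SucI[where x = 0 and c = 0], auto)

text \<open>Both bounds survive prefixing a digit: \<open>2 / 3 * (2 + 1) = 2\<close> over the
  reals, while 2-adically \<open>c / 2\<close> has size at most 2 and the factor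
  \<open>- 2 / 3\<close> halves it.\<close>

lemma finite_exps_bounds:
  assumes "x \<in> finite_exps k"
  shows "\<bar>x\<bar> \<le> 2" "abs2 x \<le> 1"
proof -
  have "\<bar>x\<bar> \<le> 2 \<and> abs2 x \<le> 1"
    using assms
  proof (induction k arbitrary: x)
    case (Suc k)
    obtain c where c: "c \<in> {0, 1, 2}" and "(- 3 / 2) * x - c / 2 \<in> finite_exps k"
      using finite_exps_leading_digit[OF Suc.prems] by blast
    define y where "y = (- 3 / 2) * x - c / 2"
    have y: "\<bar>y\<bar> \<le> 2" "abs2 y \<le> 1"
      using Suc.IH \<open>_ \<in> finite_exps k\<close> by (simp_all add: y_def)
    have x: "x = (- 2 / 3) * (y + c / 2)"
      by (simp add: y_def)
    have "abs2 (c / 2) \<le> 2"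
      using c abs2_frac[of 1 2] by auto
    then have "abs2 (y + c / 2) \<le> 2"
      using abs2_add_max[of y "c / 2"] y by linarith
    then have "abs2 x \<le> 1"
      unfolding x abs2_mult abs2_23 by simp
    moreover have "\<bar>x\<bar> \<le> 2"
      using y(1) c unfolding x abs_le_iff by (auto simp: field_simps)
    ultimately show ?case
      by simp
  qed auto
  then show "\<bar>x\<bar> \<le> 2" "abs2 x \<le> 1"
    by auto
qed

text \<open>One step of the expansion algorithm, run from the last digit to the first: emitting
  \<open>c\<close> at place \<open>Suc k\<close> replaces the remainder \<open>z\<close> by
  \<open>(c - 2 * z) / 3\<close> at place \<open>k\<close>.\<close>

lemma finite_exps_scaled_Suc:
  assumes "(- 2 / 3) ^ k * ((c - 2 * z) / 3) \<in> finite_exps k" "c \<in> {0, 1, 2}"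
  shows "(- 2 / 3) ^ Suc k * z \<in> finite_exps (Suc k)"
proof (rule finite_exps_SucI[OF assms])
  have "(- 2 / 3) * p * z = p * ((c - 2 * z) / 3) + (- 2 / 3) * p * (c / 2)" for p
    by (simp add: field_simps)
  then show "(- 2 / 3) ^ Suc k * z = (- 2 / 3) ^ k * ((c - 2 * z) / 3) + (- 2 / 3) ^ Suc k * (c / 2)"
    unfolding power_Suc .
qed

text \<open>The digits 2, 1, 1, 2 drive the remainder along -2, 2, -1, 1, 0. Four steps suffice,
  hence the exponent 4; shorter chains reach 0 at a later place.\<close>

lemma finite_exps_small_int:
  assumes "\<bar>m\<bar> \<le> (2 :: int)"
  shows "(- 2 / 3) ^ 4 * of_int m \<in> finite_exps 4"
proof -
  have e: "(- 2 / 3) ^ Suc k * z \<in> finite_exps (Suc k)"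
    if "(- 2 / 3) ^ k * z' \<in> finite_exps k" "c \<in> {0, 1, 2}" "z' = (c - 2 * z) / 3" for k z z' c
    using finite_exps_scaled_Suc that by blast
  have 0: "(- 2 / 3) ^ k * 0 \<in> finite_exps k" for k
    by (simp add: zero_in_finite_exps)
  have 1: "(- 2 / 3) ^ Suc k * 1 \<in> finite_exps (Suc k)" for k
    by (rule e[OF 0, of 2]) auto
  have m1: "(- 2 / 3) ^ Suc (Suc k) * (- 1) \<in> finite_exps (Suc (Suc k))" for k
    by (rule e[OF 1, of 1]) auto
  have 2: "(- 2 / 3) ^ Suc (Suc (Suc k)) * 2 \<in> finite_exps (Suc (Suc (Suc k)))" for k
    by (rule e[OF m1, of 1]) auto
  have m2: "(- 2 / 3) ^ Suc (Suc (Suc (Suc k))) * (- 2) \<in> finite_exps (Suc (Suc (Suc (Suc k))))" for k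
    by (rule e[OF 2, of 2]) auto
  have 4: "4 = Suc (Suc (Suc (Suc 0)))"
    by simp
  have "m = 0 \<or> m = 1 \<or> m = -1 \<or> m = 2 \<or> m = -2"
    using assms by linarith
  then show ?thesis
    using 0[of 4] 1[of 3] m1[of 2] 2[of 1] m2[of 0]
    by (elim disjE) (simp_all only: 4 of_int_0 of_int_1 of_int_minus of_int_numeral One_nat_def
        numeral_2_eq_2 numeral_3_eq_3)
qed

text \<open>The bound \<open>B j = 2 + (3 / 2) ^ j / 2\<close> is tailored to the algorithm:
  \<open>(2 + 2 * B (j + 1)) / 3 = B j\<close>, and \<open>B 0 = 5 / 2\<close> leaves only the
  integers from -2 to 2.\<close>

lemma finite_exps_scaled_dyadic:
  fixes m :: int
  assumes "\<bar>of_int m / 2 ^ j :: rat\<bar> \<le> 2 + (3 / 2) ^ j / 2"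
  shows "(- 2 / 3) ^ (j + 4) * (of_int m / 2 ^ j) \<in> finite_exps (j + 4)"
  using assms
proof (induction j arbitrary: m)
  case 0
  then have "\<bar>of_int m :: rat\<bar> < of_int 3"
    by simp
  then have "\<bar>m\<bar> \<le> 2"
    by linarith
  then show ?case
    using finite_exps_small_int by simp
next
  case (Suc j)
  \<comment> \<open>Since \<open>2 ^ j\<close> is invertible modulo 3, some digit makes
    \<open>c * 2 ^ j - m\<close> divisible by 3, so the next remainder has denominator
    \<open>2 ^ j\<close>.\<close>
  have "2 ^ j mod 3 = (1 :: int) \<or> 2 ^ j mod 3 = (2 :: int)"
  proof (induction j)
    case (Suc j)
    then show ?case
      unfolding power_Suc by presburger
  qed simp
  moreover have "m mod 3 = 0 \<or> m mod 3 = 1 \<or> m mod 3 = 2"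
    by linarith
  ultimately have "\<exists>c\<in>{0, 1, 2}. 3 dvd c * 2 ^ j - m"
    by (elim disjE) (simp; presburger)+
  then obtain c n where c: "c \<in> {0, 1, 2}" and n: "c * 2 ^ j - m = 3 * n"
    unfolding dvd_def by blast
  have nz: "of_int n / 2 ^ j = (of_int c - 2 * (of_int m / 2 ^ Suc j)) / (3 :: rat)"
  proof -
    have "of_int c * 2 ^ j - of_int m = (3 * of_int n :: rat)"
      using arg_cong[OF n, of "of_int :: int \<Rightarrow> rat"] by simp
    then show ?thesis
      by (simp add: field_simps)
  qed
  have "\<bar>of_int n / 2 ^ j :: rat\<bar> \<le> (2 + 2 * \<bar>of_int m / 2 ^ Suc j\<bar>) / 3"
  proof -
    have "\<bar>of_int c - 2 * z\<bar> \<le> 2 + 2 * \<bar>z\<bar>" for z :: rat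
      using c by auto
    from this[of "of_int m / 2 ^ Suc j"] show ?thesis
      unfolding nz abs_divide by (simp only: divide_right_mono abs_numeral zero_le_numeral)
  qed
  also have "\<dots> \<le> 2 + (3 / 2) ^ j / 2"
    using Suc.prems by simp
  finally have "(- 2 / 3) ^ (j + 4) * (of_int n / 2 ^ j) \<in> finite_exps (j + 4)"
    by (rule Suc.IH)
  then show ?case
    using finite_exps_scaled_Suc[of "j + 4" "of_int c" "of_int m / 2 ^ Suc j"] c
    unfolding nz by auto
qed

text \<open>With numerator \<open>(- 1) ^ j * n\<close> in \<open>finite_exps_scaled_dyadic\<close>,
  the sign and the powers of 2 in \<open>(- 2 / 3) ^ j\<close> cancel, leaving
  \<open>(2 / 3) ^ 4 = 16 / 81\<close>. The bound 1/2 becomes the term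
  \<open>(3 / 2) ^ j / 2\<close>.\<close>

lemma finite_exps_triadic:
  fixes n :: int
  assumes "\<bar>of_int n / 3 ^ j :: rat\<bar> \<le> 1 / 2"
  shows "16 / 81 * (of_int n / 3 ^ j) \<in> finite_exps (j + 4)"
proof -
  have "\<bar>of_int ((- 1) ^ j * n) / 2 ^ j :: rat\<bar> = (3 / 2) ^ j * \<bar>of_int n / 3 ^ j\<bar>"
    by (simp add: abs_mult power_abs field_simps)
  also have "\<dots> \<le> (3 / 2) ^ j * (1 / 2)"
    using assms by (intro mult_left_mono) auto
  also have "\<dots> \<le> 2 + (3 / 2) ^ j / 2"
    by simp
  finally have "\<bar>of_int ((- 1) ^ j * n) / 2 ^ j :: rat\<bar> \<le> 2 + (3 / 2) ^ j / 2" .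
  from finite_exps_scaled_dyadic[OF this]
  have "(- 2 / 3) ^ (j + 4) * (of_int ((- 1) ^ j * n) / 2 ^ j) \<in> finite_exps (j + 4)" .
  moreover have "(- 2 / 3 :: rat) ^ j * ((- 1) ^ j / 2 ^ j) = 1 / 3 ^ j"
    by (simp flip: power_mult_distrib power_divide add: power_one_over)
  then have "16 / 81 * of_int n * ((- 2 / 3 :: rat) ^ j * ((- 1) ^ j / 2 ^ j)) = 16 / 81 * of_int n * (1 / 3 ^ j)"
    by (rule arg_cong)
  then have "(- 2 / 3) ^ (j + 4) * (of_int ((- 1) ^ j * n) / 2 ^ j) = 16 / 81 * (of_int n / 3 ^ j :: rat)"
    by (simp add: power_add power_divide mult_ac)
  ultimately show ?thesis
    by simp
qed

section \<open>Approximation by triadic rationals\<close>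

text \<open>In lowest terms an even denominator forces an odd numerator, hence \<open>abs2 r\<close>
  at least 2.\<close>

lemma abs2_le_1_odd_denom:
  assumes "abs2 r \<le> 1"
  obtains a b :: int where "r = of_int a / of_int b" "odd b"
proof -
  obtain p q where pq: "quotient_of r = (p, q)"
    by (cases "quotient_of r")
  have r: "r = of_int p / of_int q" and "q > 0" and cop: "coprime p q"
    using quotient_of_div[OF pq] quotient_of_denom_pos[OF pq] quotient_of_coprime[OF pq] by auto
  have "odd q"
  proof
    assume "even q"
    then have "odd p"
      using cop by (meson coprime_common_divisor odd_one)
    then have "abs2 r = inverse (abs2 (of_int q))"
      by (simp add: r divide_inverse abs2_mult abs2_inverse abs2_odd)
    moreover obtain s where "q = 2 * s"
      using \<open>even q\<close> by (auto elim: dvdE)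
    then have "abs2 (of_int q) \<le> 1 / 2"
      using abs2_of_int_le_1[of s] by (simp add: abs2_mult abs2_2)
    moreover have "abs2 (of_int q) > 0"
      using \<open>q > 0\<close> abs2_nonneg[of "of_int q"] abs2_eq_0_iff[of "of_int q"] by linarith
    ultimately show False
      using assms by (simp add: field_simps)
  qed
  then show ?thesis
    using that r by blast
qed

text \<open>A congruence modulo \<open>2 ^ k\<close> on \<open>n\<close> secures 2-adic closeness.
  The admissible \<open>n / 3 ^ j\<close> still form a real grid of mesh
  \<open>2 ^ k / 3 ^ j\<close>.\<close>

lemma triadic_dense:
  fixes s :: real and v :: padic2
  assumes "padic2_abs v \<le> 1" "e > 0"
  shows "\<exists>(n :: int) j. \<bar>of_int n / 3 ^ j - s\<bar> < e \<and> padic2_abs (of_rat (of_int n / 3 ^ j) - v) < e"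
proof -
  \<comment> \<open>Distance below 1 yields \<open>abs2 r \<le> 1\<close> by the ultrametric
    inequality, hence an odd denominator.\<close>
  have "min e 1 > 0"
    using assms(2) by simp
  then obtain r where "dist (of_rat r) v < min e 1"
    using padic2_rat_dense by blast
  then have r: "padic2_abs (of_rat r - v) < e" "padic2_abs (of_rat r - v) < 1"
    by (simp_all add: dist_padic2_def)
  have "padic2_abs (of_rat r) \<le> 1"
    using padic2_abs_add_max[of "of_rat r - v" v] r(2) assms(1) by simp
  then obtain a b :: int where ab: "r = of_int a / of_int b" "odd b"
    using abs2_le_1_odd_denom by auto
  obtain k where k: "(1 / 2 :: real) ^ k < e"
    using real_arch_pow_inv[OF assms(2), of "1 / 2"] by auto
  \<comment> \<open>Chosen after \<open>k\<close>, so that the mesh \<open>2 ^ k / 3 ^ j\<close> is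
    below \<open>e\<close>.\<close>
  obtain j where j: "(1 / 3 :: real) ^ j < e / 2 ^ k"
    using real_arch_pow_inv[of "e / 2 ^ k" "1 / 3"] assms(2) by auto
  have "coprime b (2 ^ k)"
    using ab(2) by simp
  then obtain i where "[b * i = 1] (mod 2 ^ k)"
    using cong_solve_coprime_int by blast
  then have "[b * i * (3 ^ j * a) = 1 * (3 ^ j * a)] (mod 2 ^ k)"
    by (rule cong_scalar_right)
  \<comment> \<open>As \<open>i\<close> inverts \<open>b\<close> modulo \<open>2 ^ k\<close>,
    \<open>n0\<close> solves \<open>b * n0 = 3 ^ j * a\<close> modulo \<open>2 ^ k\<close>;
    \<open>n\<close> is the largest integer in its residue class not exceeding
    \<open>3 ^ j * s\<close>.\<close>
  define n0 where "n0 = i * (3 ^ j * a)"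
  define n where "n = n0 + 2 ^ k * \<lfloor>(3 ^ j * s - of_int n0) / 2 ^ k\<rfloor>"
  have "b * n = b * i * (3 ^ j * a) + 2 ^ k * (b * \<lfloor>(3 ^ j * s - of_int n0) / 2 ^ k\<rfloor>)"
    by (simp add: n_def n0_def distrib_left mult_ac)
  then have "[b * n = 3 ^ j * a] (mod 2 ^ k)"
    using \<open>[b * i * (3 ^ j * a) = 1 * (3 ^ j * a)] (mod 2 ^ k)\<close>
    by (simp add: cong_def)
  then obtain t where t: "b * n - 3 ^ j * a = 2 ^ k * t"
    by (auto simp: cong_iff_dvd_diff elim!: dvdE)
  have "b \<noteq> 0"
    using ab(2) by auto
  have "of_int b * of_int n - 3 ^ j * of_int a = (2 ^ k * of_int t :: rat)"
    using arg_cong[OF t, of "of_int :: int \<Rightarrow> rat"] by simp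
  then have "of_int n / 3 ^ j - r = 2 ^ k * of_int t * inverse (of_int (3 ^ j * b))"
    using \<open>b \<noteq> 0\<close> by (simp add: ab(1) field_simps)
  moreover have "abs2 (2 ^ k) = (1 / 2) ^ k"
    by (simp add: abs2_power abs2_2)
  moreover have "abs2 (of_int (3 ^ j * b)) = 1"
    using ab(2) by (intro abs2_odd) simp
  ultimately have "abs2 (of_int n / 3 ^ j - r) = (1 / 2) ^ k * abs2 (of_int t)"
    by (simp only: abs2_mult abs2_inverse inverse_1 mult_1_right)
  also have "\<dots> \<le> (1 / 2) ^ k"
    using abs2_of_int_le_1 by (simp add: mult_left_le)
  finally have "padic2_abs (of_rat (of_int n / 3 ^ j) - of_rat r) < e"
    using k by (simp flip: of_rat_diff)
  then have "padic2_abs (of_rat (of_int n / 3 ^ j) - v) < e"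
    using r(1) padic2_abs_add_max[of "of_rat (of_int n / 3 ^ j) - of_rat r" "of_rat r - v"] by simp
  moreover have "\<bar>of_int n / 3 ^ j - s\<bar> < e"
  proof -
    define q where "q = (3 ^ j * s - of_int n0) / 2 ^ k"
    have "of_int n - 3 ^ j * s = 2 ^ k * (of_int \<lfloor>q\<rfloor> - q)"
      by (simp add: n_def q_def field_simps)
    then have "of_int n / 3 ^ j - s = 2 ^ k * (1 / 3) ^ j * (of_int \<lfloor>q\<rfloor> - q)"
      by (simp add: field_simps)
    then have "\<bar>of_int n / 3 ^ j - s\<bar> = 2 ^ k * (1 / 3) ^ j * \<bar>of_int \<lfloor>q\<rfloor> - q\<bar>"
      by (simp add: abs_mult)
    also have "\<dots> \<le> 2 ^ k * (1 / 3) ^ j * 1"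
      by (intro mult_left_mono) (linarith, simp)
    also have "\<dots> < e"
      using j by (simp add: field_simps)
    finally show ?thesis .
  qed
  ultimately show ?thesis
    by blast
qed

section \<open>Affine maps on \<open>K\<close>\<close>

lemma dist_K_le: "dist x y \<le> \<bar>fst x - fst y\<bar> + padic2_abs (snd x - snd y)" for x y :: K
  unfolding dist_prod_def dist_real_def dist_padic2_def
  by (rule sqrt_sum_squares_le_sum) auto

text \<open>Scaling, digit removal and digit prefixing all have this form. Rational coefficients
  make these maps compatible with \<open>\<phi>\<close>, and continuity extends facts from finite
  expansions to their limits.\<close>

definition affK :: "rat \<Rightarrow> rat \<Rightarrow> K \<Rightarrow> K" where
  "affK a b x = (of_rat a * fst x + of_rat b, of_rat a * snd x + of_rat b)"

lemma continuous_on_affK: "continuous_on S (affK a b)"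
proof -
  have "(abs2 a)-lipschitz_on UNIV (\<lambda>y. of_rat a * y + of_rat b :: padic2)"
    by (rule lipschitz_onI)
       (simp_all add: dist_padic2_def padic2_abs_mult flip: right_diff_distrib)
  then have "continuous_on (snd ` S) (\<lambda>y. of_rat a * y + of_rat b :: padic2)"
    using lipschitz_on_continuous_on continuous_on_subset by blast
  then have "continuous_on S (\<lambda>x. of_rat a * snd x + of_rat b :: padic2)"
    using continuous_on_compose2[OF _ continuous_on_snd[OF continuous_on_id]] by blast
  then show ?thesis
    unfolding affK_def by (intro continuous_intros)
qed

lemma affK_\<phi>: "affK a b (\<phi> x) = \<phi> (a * x + b)"
  by (simp add: affK_def \<phi>_def of_rat_add of_rat_mult)

lemma affK_affK: "affK a b (affK c d x) = affK (a * c) (a * d + b) x"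
  by (simp add: affK_def of_rat_add of_rat_mult algebra_simps)

lemma affK_1_0 [simp]: "affK 1 0 x = x"
  by (simp add: affK_def)

section \<open>The set \<open>\<F>\<close> as the closure of the finite expansions\<close>

definition partial_exp :: "(nat \<Rightarrow> rat) \<Rightarrow> nat \<Rightarrow> rat" where
  "partial_exp c n = (\<Sum>i<n. (- 2 / 3) ^ Suc i * (c i / 2))"

lemma partial_exp_in: "(\<And>i. c i \<in> {0, 1, 2}) \<Longrightarrow> partial_exp c n \<in> finite_exps n"
proof (induction n)
  case (Suc n)
  then show ?case
    by (intro finite_exps_SucI[where x = "partial_exp c n" and c = "c n"]) (simp_all add: partial_exp_def)
qed (simp add: partial_exp_def)

text \<open>Each partial sum of the series is \<open>\<phi>\<close> of twice a
  \<open>partial_exp\<close>; halving is continuous and passes to the limit given by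
  \<open>summable_F\<close>.\<close>

lemma partial_exp_LIMSEQ:
  assumes "\<forall>i\<ge>1. d i \<in> {0, 1, 2}"
  shows "(\<lambda>n. \<phi> (partial_exp (\<lambda>i. d (Suc i)) n)) \<longlonglongrightarrow>
    scaleK (1 / 2) (\<Sum>i. scaleK ((- 3 / 2) powi (- int (Suc i))) (\<phi> (d (Suc i))))"
proof -
  let ?f = "\<lambda>i. scaleK ((- 3 / 2) powi (- int (Suc i))) (\<phi> (d (Suc i)))"
  have scaleK: "scaleK a x = affK a 0 x" for a x
    by (simp add: scaleK_def affK_def)
  have pow: "(- 3 / 2) powi (- int (Suc i)) = (- 2 / 3 :: rat) ^ Suc i" for i
  proof -
    have "(- 3 / 2) powi (- int (Suc i)) = inverse (- 3 / 2 :: rat) ^ Suc i"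
      by (simp only: power_int_minus power_int_of_nat power_inverse)
    then show ?thesis
      by (simp del: power_Suc)
  qed
  have \<phi>_add: "\<phi> x + \<phi> y = \<phi> (x + y)" for x y
    by (simp add: \<phi>_def of_rat_add)
  have "affK (1 / 2) 0 (sum ?f {..<n}) = \<phi> (partial_exp (\<lambda>i. d (Suc i)) n)" for n
  proof -
    have "sum ?f {..<n} = \<phi> (2 * partial_exp (\<lambda>i. d (Suc i)) n)"
    proof (induction n)
      case 0
      then show ?case
        by (simp add: partial_exp_def \<phi>_def prod_eq_iff)
    next
      case (Suc n)
      show ?case
        unfolding sum.lessThan_Suc Suc.IH
        unfolding scaleK affK_\<phi> \<phi>_add pow by (simp add: partial_exp_def algebra_simps)
    qed
    then show ?thesis
      by (simp add: affK_\<phi>)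
  qed
  moreover have "(\<lambda>n. affK (1 / 2) 0 (sum ?f {..<n})) \<longlonglongrightarrow> affK (1 / 2) 0 (suminf ?f)"
    by (rule continuous_on_tendsto_compose[OF continuous_on_affK[of UNIV]
          summable_LIMSEQ[OF summable_F[OF assms]]]) auto
  ultimately show ?thesis
    by (simp only: scaleK)
qed

lemma \<F>I:
  assumes "\<And>i. c i \<in> {0, 1, 2}" "(\<lambda>n. \<phi> (partial_exp c n)) \<longlonglongrightarrow> x"
  shows "x \<in> \<F>"
proof -
  \<comment> \<open>\<open>\<F>\<close> numbers its digits from 1, \<open>partial_exp\<close> from
    0.\<close>
  define d where "d i = c (i - 1)" for i
  have "\<forall>i\<ge>1. d i \<in> {0, 1, 2}"
    using assms(1) by (simp add: d_def)
  moreover from partial_exp_LIMSEQ[OF this]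
  have "x = scaleK (1 / 2) (\<Sum>i. scaleK ((- 3 / 2) powi (- int (Suc i))) (\<phi> (d (Suc i))))"
    using assms(2) by (intro LIMSEQ_unique) (simp_all add: d_def del: of_nat_Suc)
  ultimately show ?thesis
    unfolding \<F>_def by blast
qed

definition finite_points :: "K set" where
  "finite_points = \<phi> ` (\<Union>k. finite_exps k)"

lemma \<F>_subset_closure: "\<F> \<subseteq> closure finite_points"
proof
  fix x assume "x \<in> \<F>"
  then obtain d where "\<forall>i\<ge>1. d i \<in> {0, 1, 2}"
    and x: "x = scaleK (1 / 2) (\<Sum>i. scaleK ((- 3 / 2) powi (- int (Suc i))) (\<phi> (d (Suc i))))"
    unfolding \<F>_def by blast
  then have "(\<lambda>n. \<phi> (partial_exp (\<lambda>i. d (Suc i)) n)) \<longlonglongrightarrow> x"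
    using partial_exp_LIMSEQ by blast
  moreover have "\<phi> (partial_exp (\<lambda>i. d (Suc i)) n) \<in> finite_points" for n
    unfolding finite_points_def using \<open>\<forall>i\<ge>1. _\<close> by (intro imageI UN_I[of n] partial_exp_in) auto
  ultimately show "x \<in> closure finite_points"
    unfolding closure_sequential by (intro exI conjI allI)
qed

text \<open>Each digit gives a closed preimage, and a union of three closed sets is closed; it
  contains \<open>finite_points\<close>, hence the closure.\<close>

lemma closure_leading_digit:
  assumes "x \<in> closure finite_points"
  shows "\<exists>c\<in>{0, 1, 2}. affK (- 3 / 2) (- c / 2) x \<in> closure finite_points"
proof -
  let ?S = "\<Union>c\<in>{0, 1, 2}. affK (- 3 / 2) (- c / 2) -` closure finite_points"
  have "finite_points \<subseteq> ?S"
  proof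
    fix x assume "x \<in> finite_points"
    then obtain w k where w: "x = \<phi> w" "w \<in> finite_exps k"
      by (auto simp: finite_points_def)
    \<comment> \<open>Padding with a digit 0 guarantees a digit to remove, even for
      \<open>k = 0\<close>.\<close>
    then have "w \<in> finite_exps (Suc k)"
      by (intro finite_exps_SucI[of w k 0]) auto
    then obtain c where c: "c \<in> {0, 1, 2}" "(- 3 / 2) * w - c / 2 \<in> finite_exps k"
      using finite_exps_leading_digit by blast
    then have "affK (- 3 / 2) (- c / 2) x \<in> finite_points"
      unfolding w(1) affK_\<phi> by (auto simp: finite_points_def)
    then show "x \<in> ?S"
      using c(1) closure_subset by blast
  qed
  moreover have "closed ?S"
    by (intro closed_UN ballI closed_vimage closed_closure continuous_on_affK) simp
  ultimately have "closure finite_points \<subseteq> ?S"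
    by (rule closure_minimal)
  then show ?thesis
    using assms by blast
qed

lemma closure_bounds:
  assumes "x \<in> closure finite_points"
  shows "\<bar>fst x\<bar> \<le> 2" "padic2_abs (snd x) \<le> 1"
proof -
  let ?S = "{x :: K. dist (fst x) 0 \<le> 2 \<and> dist (snd x) 0 \<le> 1}"
  have "finite_points \<subseteq> ?S"
  proof
    fix x assume "x \<in> finite_points"
    then obtain w k where w: "x = \<phi> w" "w \<in> finite_exps k"
      by (auto simp: finite_points_def)
    have "\<bar>of_rat w :: real\<bar> = of_rat \<bar>w\<bar>"
      by (simp add: abs_if of_rat_minus)
    also have "\<dots> \<le> of_rat 2"
      using finite_exps_bounds(1)[OF w(2)] by (simp only: of_rat_less_eq)
    finally show "x \<in> ?S"
      using finite_exps_bounds(2)[OF w(2)] by (simp add: w(1) \<phi>_def dist_padic2_def)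
  qed
  moreover have "closed ?S"
    by (intro closed_Collect_conj closed_Collect_le continuous_intros)
  ultimately have "x \<in> ?S"
    using assms closure_minimal by blast
  then show "\<bar>fst x\<bar> \<le> 2" "padic2_abs (snd x) \<le> 1"
    by (simp_all add: dist_padic2_def)
qed

text \<open>Iterated digit removal gives an orbit \<open>X\<close> inside the closure. After
  \<open>n\<close> steps \<open>x\<close> differs from \<open>\<phi> (partial_exp c n)\<close> by
  \<open>X n\<close> scaled by \<open>(- 2 / 3) ^ n\<close>; as the orbit is bounded, this tends to
  0 in both coordinates.\<close>

lemma closure_subset_\<F>: "closure finite_points \<subseteq> \<F>"
proof
  fix x assume x: "x \<in> closure finite_points"
  obtain g where g: "\<And>y. y \<in> closure finite_points \<Longrightarrow>
      g y \<in> {0, 1, 2} \<and> affK (- 3 / 2) (- g y / 2) y \<in> closure finite_points"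
    using closure_leading_digit by metis
  define X where "X = rec_nat x (\<lambda>n y. affK (- 3 / 2) (- g y / 2) y)"
  have X_Suc: "X (Suc n) = affK (- 3 / 2) (- g (X n) / 2) (X n)" for n
    by (simp add: X_def)
  have X: "X n \<in> closure finite_points" for n
  proof (induction n)
    case (Suc n)
    then show ?case
      using g X_Suc by simp
  qed (simp add: X_def x)
  define c where "c n = g (X n)" for n
  have c: "c n \<in> {0, 1, 2}" for n
    using g[OF X] by (simp add: c_def)
  have exp: "x = affK ((- 2 / 3) ^ n) (partial_exp c n) (X n)" for n
  proof (induction n)
    case (Suc n)
    have "X n = affK (- 2 / 3) (- c n / 3) (X (Suc n))"
      unfolding X_Suc affK_affK by (simp add: c_def)
    then have "x = affK ((- 2 / 3) ^ n) (partial_exp c n) (affK (- 2 / 3) (- c n / 3) (X (Suc n)))"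
      using Suc.IH by simp
    moreover have "(- 2 / 3) ^ n * (- c n / 3) + partial_exp c n = partial_exp c (Suc n)"
      by (simp add: partial_exp_def)
    ultimately show ?case
      unfolding affK_affK power_Suc2 by simp
  qed (simp add: partial_exp_def X_def)
  have "(\<lambda>n. \<phi> (partial_exp c n)) \<longlonglongrightarrow> x"
  proof (rule iffD2[OF tendsto_dist_iff], rule tendsto_sandwich[OF _ _ tendsto_const])
    show "\<forall>\<^sub>F n in sequentially. dist (\<phi> (partial_exp c n)) x \<le> (2 / 3) ^ n * 2 + (1 / 2) ^ n"
    proof (intro always_eventually allI)
      fix n
      have "dist (\<phi> (partial_exp c n)) x
          \<le> \<bar>of_rat ((- 2 / 3) ^ n) * fst (X n)\<bar> + padic2_abs (of_rat ((- 2 / 3) ^ n) * snd (X n))"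
        using dist_K_le[of "x" "\<phi> (partial_exp c n)"]
        \<comment> \<open>Only the occurrences of \<open>x\<close> under \<open>fst\<close> and
          \<open>snd\<close> are expanded; the one in \<open>dist\<close> stays.\<close>
        by (subst (asm) (2 3) exp[of n]) (simp add: affK_def \<phi>_def dist_commute)
      also have "\<dots> = (2 / 3) ^ n * \<bar>fst (X n)\<bar> + (1 / 2) ^ n * padic2_abs (snd (X n))"
      proof -
        have "\<bar>of_rat ((- 2 / 3) ^ n) :: real\<bar> = (2 / 3) ^ n"
          by (simp only: of_rat_power power_abs) (simp add: of_rat_divide of_rat_minus)
        then show ?thesis
          by (simp only: padic2_abs_mult padic2_abs_of_rat abs2_power abs2_23 abs_mult)
      qed
      also have "\<dots> \<le> (2 / 3) ^ n * 2 + (1 / 2) ^ n * 1"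
        using closure_bounds[OF X] by (intro add_mono mult_left_mono) auto
      also have "\<dots> = (2 / 3) ^ n * 2 + (1 / 2) ^ n"
        by simp
      finally show "dist (\<phi> (partial_exp c n)) x \<le> (2 / 3) ^ n * 2 + (1 / 2) ^ n" .
    qed
    show "(\<lambda>n. (2 / 3) ^ n * 2 + (1 / 2) ^ n :: real) \<longlonglongrightarrow> 0"
      by (intro tendsto_add_zero tendsto_mult_left_zero LIMSEQ_realpow_zero) auto
  qed simp
  then show "x \<in> \<F>"
    using \<F>I c by blast
qed

section \<open>Interior points\<close>

lemma zero_neighbourhood:
  obtains U :: "K set" where "open U" "0 \<in> U" "U \<subseteq> closure finite_points"
proof
  \<comment> \<open>The radii are 16/81 times 1/2 and the 2-adic size of 16/81, so dividing by 16/81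
    lands in the range of \<open>finite_exps_triadic\<close> and in the 2-adic unit ball.\<close>
  let ?U = "{x :: K. dist (fst x) 0 < 8 / 81 \<and> dist (snd x) 0 < 1 / 16}"
  show "open ?U"
    by (intro open_Collect_conj open_Collect_less continuous_intros)
  show "0 \<in> ?U"
    by simp
  show "?U \<subseteq> closure finite_points"
  proof
    fix x assume "x \<in> ?U"
    then have x: "\<bar>fst x\<bar> < 8 / 81" "padic2_abs (snd x) < 1 / 16"
      by (simp_all add: dist_padic2_def)
    have abs2_r: "abs2 (16 / 81) = 1 / 16" "abs2 (81 / 16) = 16"
    proof -
      have "abs2 81 = 1" "abs2 16 = 1 / 16"
        using abs2_odd[of 81] abs2_power[of 2 4] by (simp_all add: abs2_2 power_divide)
      then show "abs2 (16 / 81) = 1 / 16" "abs2 (81 / 16) = 16"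
        by (simp_all only: abs2_divide) simp_all
    qed
    define s where "s = 81 / 16 * fst x"
    define v where "v = of_rat (81 / 16) * snd x"
    have s: "\<bar>s\<bar> < 1 / 2" and v: "padic2_abs v \<le> 1"
      using x by (simp_all add: s_def v_def padic2_abs_mult abs2_r)
    show "x \<in> closure finite_points"
      unfolding closure_approachable
    proof (intro allI impI)
      fix e :: real assume "e > 0"
      \<comment> \<open>The margin \<open>1 / 2 - \<bar>s\<bar>\<close> keeps the approximating
        fraction within 1/2 of 0.\<close>
      then have "min e (1 / 2 - \<bar>s\<bar>) > 0"
        using s by simp
      from triadic_dense[OF v this, of s] obtain n j
        where n: "\<bar>of_int n / 3 ^ j - s\<bar> < min e (1 / 2 - \<bar>s\<bar>)"
          "padic2_abs (of_rat (of_int n / 3 ^ j) - v) < min e (1 / 2 - \<bar>s\<bar>)"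
        by blast
      define q :: rat where "q = of_int n / 3 ^ j"
      have q: "of_int n / 3 ^ j = (of_rat q :: real)"
        by (simp add: q_def of_rat_divide of_rat_power)
      have "of_rat \<bar>q\<bar> \<le> (of_rat (1 / 2) :: real)"
        using n(1) unfolding q by (auto simp: abs_if of_rat_minus of_rat_divide split: if_splits)
      then have "\<bar>q\<bar> \<le> 1 / 2"
        by (simp only: of_rat_less_eq)
      then have "16 / 81 * q \<in> finite_exps (j + 4)"
        unfolding q_def by (rule finite_exps_triadic)
      then have "\<phi> (16 / 81 * q) \<in> finite_points"
        unfolding finite_points_def by blast
      moreover have "dist (\<phi> (16 / 81 * q)) x < e"
      proof -
        have "fst (\<phi> (16 / 81 * q)) - fst x = 16 / 81 * (of_rat q - s)"
          by (simp add: \<phi>_def s_def of_rat_mult of_rat_divide algebra_simps)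
        moreover have "snd (\<phi> (16 / 81 * q)) - snd x = of_rat (16 / 81) * (of_rat q - v)"
          by (simp add: \<phi>_def v_def of_rat_mult of_rat_divide algebra_simps)
        ultimately have "dist (\<phi> (16 / 81 * q)) x
            \<le> 16 / 81 * \<bar>of_rat q - s\<bar> + 1 / 16 * padic2_abs (of_rat q - v)"
          using dist_K_le[of "\<phi> (16 / 81 * q)" x]
          by (simp only: padic2_abs_mult padic2_abs_of_rat abs2_r abs_mult)
        also have "\<dots> < e"
          using n \<open>e > 0\<close> unfolding q q_def[symmetric] by simp
        finally show ?thesis .
      qed
      ultimately show "\<exists>y\<in>finite_points. dist y x < e"
        by blast
    qed
  qed
qed

text \<open>Prefixing the digits of \<open>w\<close> is the map \<open>affK a w\<close>; it sends 0
  to \<open>\<phi> w\<close> and preserves \<open>finite_points\<close>, hence also the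
  closure.\<close>

lemma finite_points_subset_interior: "finite_points \<subseteq> interior (closure finite_points)"
proof
  fix x assume "x \<in> finite_points"
  then obtain w k where w: "x = \<phi> w" "w \<in> finite_exps k"
    by (auto simp: finite_points_def)
  obtain U :: "K set" where U: "open U" "0 \<in> U" "U \<subseteq> closure finite_points"
    by (rule zero_neighbourhood)
  define a :: rat where "a = (- 2 / 3) ^ k"
  have "a \<noteq> 0"
    by (simp add: a_def)
  let ?h = "affK (inverse a) (- w * inverse a)"
  have inv: "affK a w (?h y) = y" for y
  proof -
    have "a * (- w * inverse a) + w = 0" "a * inverse a = 1"
      using \<open>a \<noteq> 0\<close> by simp_all
    then show ?thesis
      by (simp only: affK_affK affK_1_0)
  qed
  have "affK a w ` finite_points \<subseteq> finite_points"
  proof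
    fix y assume "y \<in> affK a w ` finite_points"
    then obtain z l where "z \<in> finite_exps l" "y = \<phi> (w + a * z)"
      by (auto simp: finite_points_def affK_\<phi> add.commute)
    then show "y \<in> finite_points"
      using finite_exps_append[OF w(2)] unfolding finite_points_def a_def by blast
  qed
  then have "affK a w ` closure finite_points \<subseteq> closure finite_points"
    by (intro image_closure_subset continuous_on_affK closed_closure)
       (use closure_subset in blast)
  \<comment> \<open>The image of \<open>U\<close> is handled through the preimage under the inverse
    map \<open>?h\<close>, whose openness follows from continuity.\<close>
  moreover have "?h -` U \<subseteq> affK a w ` U"
    using inv by (metis image_eqI subsetI vimageE)
  ultimately have "?h -` U \<subseteq> closure finite_points"
    using U(3) by blast
  moreover have "open (?h -` U)"
    using U(1) by (intro open_vimage continuous_on_affK)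
  moreover have "x \<in> ?h -` U"
    using U(2) by (simp add: w(1) affK_\<phi>) (simp add: \<phi>_def zero_prod_def algebra_simps)
  ultimately show "x \<in> interior (closure finite_points)"
    by (rule interiorI[rotated 2])
qed

theorem theorem4:
  shows "\<F> = K_topology closure_of (K_topology interior_of \<F>)"
proof -
  have F: "\<F> = closure finite_points"
    using \<F>_subset_closure closure_subset_\<F> by blast
  have "\<F> \<subseteq> closure (interior \<F>)"
    unfolding F by (rule closure_mono[OF finite_points_subset_interior])
  moreover have "closure (interior \<F>) \<subseteq> \<F>"
    by (rule closure_minimal[OF interior_subset]) (simp add: F)
  ultimately show ?thesis
    by (simp add: K_topology_eq_euclidean)
qed

end
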